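(* Let $Q$ be a quadrilateral in $\mathbb{R}^2$ (not necessarily simple or convex) that is not a parallelogram, and suppose that no three vertices of $Q$ lie on a line. Then there exists a line $L$ with the following properties: 1. The midpoints of the two diagonals of $Q$ lie on $L$. If $Q$ is not a trapezoid, the third diagonal midpoint of $Q$ lies on $L$. 2. If $c$ is the center of some ellipse or hyperbola tangent to the four extended sides of $Q$, then $c$ lies on $L$. 3. Every point of $L$, except the midpoints of the two diagonals of $Q$ and (if $Q$ is not a trapezoid) the third diagonal midpoint of $Q$, is the center of some ellipse or hyperbola tangent to the four extended sides of $Q$.
   Context: A quadrilateral $Q$ is given by four vertices $q^{(1)},q^{(2)},q^{(3)},q^{(4)}\in\mathbb{R}^2$ listed in order. Its sides are the segments $q^{(1)}q^{(2)}$, $q^{(2)}q^{(3)}$, $q^{(3)}q^{(4)}$, $q^{(4)}q^{(1)}$; its extended sides are the lines containing these segments; its diagonals are $q^{(1)}q^{(3)}$ and $q^{(2)}q^{(4)}$. A trapezoid is a quadrilateral with at least one pair of parallel opposite sides (so parallelograms are trapezoids); a parallelogram has both pairs of opposite sides parallel. Third diagonal midpoint: let $Q$ be a quadrilateral that is not a trapezoid, and let $L_1,L_2,L_3,L_4$ be its four extended sides in order. If $L_1$ meets $L_3$ at $p$ and $L_2$ meets $L_4$ at $q$, then $p$ and $q$ are the two hidden vertices of $Q$ and $\frac{p+q}{2}$ is the third diagonal midpoint of $Q$. Ellipses (including circles) and hyperbolas are non-degenerate. A point $c$ is a center of a set $U\subseteq\mathbb{R}^2$ if $x\in U$ implies $2c-x\in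 U$; an ellipse or hyperbola has exactly one center. Tangency: a line $L$ is directed along a conic $H$ if $H$ is a hyperbola and $L$ is parallel to one of the two asymptotes of $H$, or $H$ is a parabola and $L$ is parallel to its axis of symmetry (a line is parallel to itself; no line is directed along an ellipse). A line $L$ is tangent to a conic $H$ if either (1) $L$ intersects $H$ at exactly one point and is not directed along $H$, or (2) $H$ is a hyperbola and $L$ is one of its two asymptotes. *)

theory Defs
  imports "HOL-Analysis.Analysis"
begin

type_synonym plane = "real ^ 2"

definition is_line :: "plane set \<Rightarrow> bool" where
  "is_line L \<longleftrightarrow> (\<exists>p q. p \<noteq> q \<and> L = affine hull {p, q})"

(* This is a line only when p \<noteq> q. *)
definition line_through :: "plane \<Rightarrow> plane \<Rightarrow> plane set" where
  "line_through p q = affine hull {p, q}"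

(* A quadrilateral is given by its four vertices in order. Parallelism of lines is
   affine_parallel (being translates of each other), so a line is parallel to itself. *)

definition extended_sides :: "plane \<Rightarrow> plane \<Rightarrow> plane \<Rightarrow> plane \<Rightarrow> plane set set" where
  "extended_sides q1 q2 q3 q4 =
     {line_through q1 q2, line_through q2 q3, line_through q3 q4, line_through q4 q1}"

definition trapezoid :: "plane \<Rightarrow> plane \<Rightarrow> plane \<Rightarrow> plane \<Rightarrow> bool" where
  "trapezoid q1 q2 q3 q4 \<longleftrightarrow>
     affine_parallel (line_through q1 q2) (line_through q3 q4) \<or>
     affine_parallel (line_through q2 q3) (line_through q4 q1)"

definition parallelogram :: "plane \<Rightarrow> plane \<Rightarrow> plane \<Rightarrow> plane \<Rightarrow> bool" where
  "parallelogram q1 q2 q3 q4 \<longleftrightarrow>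
     affine_parallel (line_through q1 q2) (line_through q3 q4) \<and>
     affine_parallel (line_through q2 q3) (line_through q4 q1)"

(* Meaningful only if q1, q2, q3, q4 is not a trapezoid: then both intersections are
   singletons, consisting of the two hidden vertices. *)
definition third_diagonal_midpoint :: "plane \<Rightarrow> plane \<Rightarrow> plane \<Rightarrow> plane \<Rightarrow> plane" where
  "third_diagonal_midpoint q1 q2 q3 q4 =
     midpoint (the_elem (line_through q1 q2 \<inter> line_through q3 q4))
              (the_elem (line_through q2 q3 \<inter> line_through q4 q1))"

definition orthonormal_pair :: "plane \<Rightarrow> plane \<Rightarrow> bool" where
  "orthonormal_pair u v \<longleftrightarrow> norm u = 1 \<and> norm v = 1 \<and> u \<bullet> v = 0"

(* Conics are curves with the usual canonical equation in a Cartesian coordinate system with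
   origin c and axes directed by u and v. For ellipses a = b gives the circles. *)

definition is_ellipse :: "plane set \<Rightarrow> bool" where
  "is_ellipse H \<longleftrightarrow>
     (\<exists>c u v a b. orthonormal_pair u v \<and> a > 0 \<and> b > 0 \<and>
        H = {c + x *\<^sub>R u + y *\<^sub>R v | x y. x\<^sup>2 / a\<^sup>2 + y\<^sup>2 / b\<^sup>2 = 1})"

definition std_hyperbola :: "plane \<Rightarrow> plane \<Rightarrow> plane \<Rightarrow> real \<Rightarrow> real \<Rightarrow> plane set" where
  "std_hyperbola c u v a b =
     {c + x *\<^sub>R u + y *\<^sub>R v | x y. x\<^sup>2 / a\<^sup>2 - y\<^sup>2 / b\<^sup>2 = 1}"

definition is_hyperbola :: "plane set \<Rightarrow> bool" where
  "is_hyperbola H \<longleftrightarrow>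
     (\<exists>c u v a b. orthonormal_pair u v \<and> a > 0 \<and> b > 0 \<and> H = std_hyperbola c u v a b)"

(* The lines y = (b / a) x and y = - (b / a) x in the coordinates of the canonical equation;
   they do not depend on the choice of that equation. *)
definition is_asymptote :: "plane set \<Rightarrow> plane set \<Rightarrow> bool" where
  "is_asymptote L H \<longleftrightarrow>
     (\<exists>c u v a b. orthonormal_pair u v \<and> a > 0 \<and> b > 0 \<and> H = std_hyperbola c u v a b \<and>
        (L = line_through c (c + a *\<^sub>R u + b *\<^sub>R v) \<or>
         L = line_through c (c + a *\<^sub>R u - b *\<^sub>R v)))"

definition std_parabola :: "plane \<Rightarrow> plane \<Rightarrow> plane \<Rightarrow> real \<Rightarrow> plane set" where
  "std_parabola c u v a = {c + x *\<^sub>R u + y *\<^sub>R v | x y. y = a * x\<^sup>2}"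

definition is_parabola_axis :: "plane set \<Rightarrow> plane set \<Rightarrow> bool" where
  "is_parabola_axis L H \<longleftrightarrow>
     (\<exists>c u v a. orthonormal_pair u v \<and> a > 0 \<and> H = std_parabola c u v a \<and>
        L = line_through c (c + v))"

definition is_center :: "plane \<Rightarrow> plane set \<Rightarrow> bool" where
  "is_center c U \<longleftrightarrow> (\<forall>x \<in> U. 2 *\<^sub>R c - x \<in> U)"

(* The existence of an asymptote (of an axis) of H in the sense above already entails that
   H is a hyperbola (a parabola). *)

definition directed_along :: "plane set \<Rightarrow> plane set \<Rightarrow> bool" where
  "directed_along L H \<longleftrightarrow>
     (\<exists>A. is_asymptote A H \<and> affine_parallel L A) \<or>
     (\<exists>A. is_parabola_axis A H \<and> affine_parallel L A)"

definition tangent_to :: "plane set \<Rightarrow> plane set \<Rightarrow> bool" where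
  "tangent_to L H \<longleftrightarrow>
     ((\<exists>!x. x \<in> L \<inter> H) \<and> \<not> directed_along L H) \<or> is_asymptote L H"

(* c is the center of some ellipse or hyperbola tangent to all lines in S. *)
definition center_of_tangent_conic :: "plane set set \<Rightarrow> plane \<Rightarrow> bool" where
  "center_of_tangent_conic S c \<longleftrightarrow>
     (\<exists>H. (is_ellipse H \<or> is_hyperbola H) \<and> is_center c H \<and> (\<forall>L \<in> S. tangent_to L H))"

end

(* A central conic with centre c has a dual quadratic form B such that the line n x = d is tangent
   to it if and only if B(n) = (d - n c)^2; asymptotes are included because they are the lines with
   B(n) = 0 through c. So c is the centre of a conic tangent to the four sides if and only if four
   linear equations in the three coefficients of B have a nondegenerate solution. The squares of the
   four normals are linearly dependent, and since this dependency cancels the part quadratic in c,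
   solvability is a linear condition on c, which holds on the line through the midpoints of the
   diagonals. A solution takes squares as values, so it is never negative definite, and it is
   degenerate only if all four sides pass through one of two points symmetric about c, that is, if c
   is a midpoint of one of the three diagonals. *)

theory Submission
  imports Defs
begin

section \<open>Determinants, lines and parallelism in the plane\<close>

definition det2 :: "plane \<Rightarrow> plane \<Rightarrow> real" where
  "det2 x y = x $ 1 * y $ 2 - x $ 2 * y $ 1"

lemma plane_eq_iff: "x = y \<longleftrightarrow> x $ 1 = y $ 1 \<and> x $ 2 = y $ 2" for x y :: plane
  by (simp add: vec_eq_iff forall_2)

lemma inner_plane: "x \<bullet> y = x $ 1 * y $ 1 + x $ 2 * y $ 2" for x y :: plane
  by (simp add: inner_vec_def sum_2)

lemma det2_eq_0_iff:
  assumes "e \<noteq> 0"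
  shows "det2 e x = 0 \<longleftrightarrow> (\<exists>k. x = k *\<^sub>R e)"
proof
  assume d: "det2 e x = 0"
  show "\<exists>k. x = k *\<^sub>R e"
  proof (cases "e $ 1 = 0")
    case True
    with assms have "e $ 2 \<noteq> 0" by (simp add: plane_eq_iff)
    with d True show ?thesis
      by (intro exI[of _ "x $ 2 / e $ 2"]) (simp add: plane_eq_iff det2_def)
  next
    case False
    with d show ?thesis
      by (intro exI[of _ "x $ 1 / e $ 1"]) (simp add: plane_eq_iff det2_def field_simps)
  qed
qed (auto simp: det2_def)

lemma line_through_eq: "line_through p q = {p + t *\<^sub>R (q - p) | t. True}"
proof -
  have "\<exists>t. u *\<^sub>R p + v *\<^sub>R q = p + t *\<^sub>R (q - p)" if "u + v = 1" for u v
  proof -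
    from that have u: "u = 1 - v" by simp
    show ?thesis unfolding u by (intro exI[of _ v]) (simp add: algebra_simps)
  qed
  moreover have "\<exists>u v. p + t *\<^sub>R (q - p) = u *\<^sub>R p + v *\<^sub>R q \<and> u + v = 1" for t
    by (intro exI[of _ "1 - t"] exI[of _ t]) (simp add: algebra_simps)
  ultimately show ?thesis
    unfolding line_through_def affine_hull_2 by blast
qed

lemma mem_line_through_iff:
  assumes "p \<noteq> q"
  shows "x \<in> line_through p q \<longleftrightarrow> det2 (q - p) (x - p) = 0"
  using assms by (subst det2_eq_0_iff) (auto simp: line_through_eq algebra_simps)

lemma collinear_iff_det2:
  assumes "p \<noteq> q"
  shows "collinear {p, q, x} \<longleftrightarrow> det2 (q - p) (x - p) = 0"
  using assms collinear_3_affine_hull[OF assms, of x] mem_line_through_iff[OF assms, of x]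
  by (simp add: line_through_def)

lemma affine_parallel_iff_det2:
  assumes "p \<noteq> q" "p' \<noteq> q'"
  shows "affine_parallel (line_through p q) (line_through p' q') \<longleftrightarrow> det2 (q - p) (q' - p') = 0"
proof
  assume "affine_parallel (line_through p q) (line_through p' q')"
  then obtain z where z: "line_through p' q' = (\<lambda>x. z + x) ` line_through p q"
    unfolding affine_parallel_def by blast
  have "p' \<in> line_through p' q'" "q' \<in> line_through p' q'"
    by (simp_all add: line_through_def hull_inc)
  then obtain s t where st: "p' = z + (p + s *\<^sub>R (q - p))" "q' = z + (p + t *\<^sub>R (q - p))"
    unfolding z by (auto simp: line_through_eq)
  have "q' - p' = (t - s) *\<^sub>R (q - p)" unfolding st by (simp add: algebra_simps)
  with assms show "det2 (q - p) (q' - p') = 0" by (subst det2_eq_0_iff) auto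
next
  assume "det2 (q - p) (q' - p') = 0"
  with assms obtain k where k: "q' - p' = k *\<^sub>R (q - p)" by (auto simp: det2_eq_0_iff)
  with assms have "k \<noteq> 0" by auto
  have "p' + t *\<^sub>R (q' - p') = (p' - p) + (p + (t * k) *\<^sub>R (q - p))" for t
    by (simp add: k)
  moreover have "(p' - p) + (p + t *\<^sub>R (q - p)) = p' + (t / k) *\<^sub>R (q' - p')" for t
    using \<open>k \<noteq> 0\<close> by (simp add: k)
  ultimately have "line_through p' q' = (\<lambda>x. (p' - p) + x) ` line_through p q"
    unfolding line_through_eq image_def by blast
  then show "affine_parallel (line_through p q) (line_through p' q')"
    unfolding affine_parallel_def by blast
qed

section \<open>Central conics\<close>

text \<open>The direction of \<open>e\<close> is that of an asymptote or of a parabola axis; this makes these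
  directions independent of the choice of the canonical equation.\<close>

definition once_direction :: "plane set \<Rightarrow> plane \<Rightarrow> bool" where
  "once_direction H e \<longleftrightarrow> (\<forall>p\<in>H. \<forall>t. p + t *\<^sub>R e \<in> H \<longrightarrow> t = 0)"

lemma once_direction_scaleR:
  assumes "once_direction H e" "k \<noteq> 0"
  shows "once_direction H (k *\<^sub>R e)"
  using assms unfolding once_direction_def by (metis mult_eq_0_iff scaleR_scaleR)

lemma once_direction_parallel:
  assumes "once_direction H e" "e \<noteq> 0" "p \<noteq> q" "affine_parallel (line_through p q) (line_through z (z + e))"
  shows "once_direction H (q - p)"
proof -
  have "det2 (q - p) (z + e - z) = 0"
    using affine_parallel_iff_det2[of p q z "z + e"] assms(2-4) by simp
  then have "det2 e (q - p) = 0" by (simp add: det2_def algebra_simps)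
  with assms(2) obtain k where "q - p = k *\<^sub>R e" by (auto simp: det2_eq_0_iff)
  with assms(3) show ?thesis by (auto intro!: once_direction_scaleR[OF assms(1)])
qed

text \<open>Lagrange's identity. Only the square is determined, since the pair may have either
  orientation.\<close>

lemma orthonormal_pair_det2:
  assumes "orthonormal_pair u v"
  shows "(det2 u v)\<^sup>2 = 1"
proof -
  have "u \<bullet> u = 1" "v \<bullet> v = 1" "u \<bullet> v = 0"
    using assms by (auto simp: orthonormal_pair_def norm_eq_1)
  then have "u $ 1 * u $ 1 + u $ 2 * u $ 2 = 1" "v $ 1 * v $ 1 + v $ 2 * v $ 2 = 1"
    "u $ 1 * v $ 1 + u $ 2 * v $ 2 = 0" by (simp_all add: inner_plane)
  moreover have "(det2 u v)\<^sup>2 = (u $ 1 * u $ 1 + u $ 2 * u $ 2) * (v $ 1 * v $ 1 + v $ 2 * v $ 2) - 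
    (u $ 1 * v $ 1 + u $ 2 * v $ 2)\<^sup>2"
    unfolding det2_def by algebra
  ultimately show ?thesis by simp
qed

text \<open>Passing to coordinates along \<open>u\<close> and \<open>v\<close> multiplies a
  determinant by \<open>det2 u v\<close>, which is 1 or -1.\<close>

lemma orthonormal_pair_cross:
  assumes "orthonormal_pair u v"
  shows "((x \<bullet> u) * (y \<bullet> v) - (x \<bullet> v) * (y \<bullet> u))\<^sup>2 = (det2 x y)\<^sup>2"
proof -
  have "(x \<bullet> u) * (y \<bullet> v) - (x \<bullet> v) * (y \<bullet> u) = det2 x y * det2 u v"
    unfolding det2_def inner_plane by algebra
  with orthonormal_pair_det2[OF assms] show ?thesis by (simp add: power_mult_distrib)
qed

lemma orthonormal_pair_expand:
  assumes "orthonormal_pair u v"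
  shows "x = (x \<bullet> u) *\<^sub>R u + (x \<bullet> v) *\<^sub>R v"
proof -
  define d where "d = x - (x \<bullet> u) *\<^sub>R u - (x \<bullet> v) *\<^sub>R v"
  have "u \<bullet> u = 1" "v \<bullet> v = 1" "u \<bullet> v = 0" "v \<bullet> u = 0"
    using assms by (auto simp: orthonormal_pair_def norm_eq_1 inner_commute)
  then have "d \<bullet> u = 0" "d \<bullet> v = 0" by (simp_all add: d_def inner_diff_left)
  \<comment> \<open>Cramer's rule recovers the components of \<open>d\<close> from its two inner
    products.\<close>
  moreover have "d $ 1 * det2 u v = (d \<bullet> u) * v $ 2 - (d \<bullet> v) * u $ 2"
    "d $ 2 * det2 u v = (d \<bullet> v) * u $ 1 - (d \<bullet> u) * v $ 1"
    unfolding det2_def inner_plane by algebra+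
  moreover have "det2 u v \<noteq> 0" using orthonormal_pair_det2[OF assms] by auto
  ultimately have "d = 0" by (simp add: plane_eq_iff)
  then show ?thesis by (simp add: d_def algebra_simps)
qed

text \<open>With \<open>\<mu> = a\<^sup>2\<close> the choice \<open>\<nu> = b\<^sup>2\<close> gives the ellipses and \<open>\<nu> = - b\<^sup>2\<close> the hyperbolas.\<close>

locale central_conic =
  fixes c u v :: plane and \<mu> \<nu> :: real
  assumes uv: "orthonormal_pair u v" and mu: "\<mu> \<noteq> 0" and nu: "\<nu> \<noteq> 0"
begin

definition conic :: "plane set" where
  "conic = {x. ((x - c) \<bullet> u)\<^sup>2 / \<mu> + ((x - c) \<bullet> v)\<^sup>2 / \<nu> = 1}"

text \<open>The equation of the conic restricted to the line \<open>t \<mapsto> p + t e\<close> is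
  \<open>quad e t\<^sup>2 + 2 polar p e t + val p = 0\<close>; the form \<open>dual\<close> is the one of the dual conic,
  written in directions of lines instead of normals.\<close>

definition quad :: "plane \<Rightarrow> real" where
  "quad e = (e \<bullet> u)\<^sup>2 / \<mu> + (e \<bullet> v)\<^sup>2 / \<nu>"

definition polar :: "plane \<Rightarrow> plane \<Rightarrow> real" where
  "polar p e = ((p - c) \<bullet> u) * (e \<bullet> u) / \<mu> + ((p - c) \<bullet> v) * (e \<bullet> v) / \<nu>"

definition val :: "plane \<Rightarrow> real" where
  "val p = quad (p - c) - 1"

definition dual :: "plane \<Rightarrow> real" where
  "dual e = \<mu> * (e \<bullet> v)\<^sup>2 + \<nu> * (e \<bullet> u)\<^sup>2"

lemma uv_simps [simp]: "u \<bullet> u = 1" "v \<bullet> v = 1" "u \<bullet> v = 0" "v \<bullet> u = 0"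
  using uv by (auto simp: orthonormal_pair_def norm_eq_1 inner_commute)

lemma conic_iff: "p \<in> conic \<longleftrightarrow> val p = 0"
  by (simp add: conic_def val_def quad_def)

lemma conic_alt: "conic = {c + x *\<^sub>R u + y *\<^sub>R v | x y. x\<^sup>2 / \<mu> + y\<^sup>2 / \<nu> = 1}" (is "_ = ?R")
proof
  show "conic \<subseteq> ?R"
  proof
    fix p assume "p \<in> conic"
    moreover have "p = c + ((p - c) \<bullet> u) *\<^sub>R u + ((p - c) \<bullet> v) *\<^sub>R v"
      using orthonormal_pair_expand[OF uv, of "p - c"] by (simp add: algebra_simps)
    ultimately show "p \<in> ?R" unfolding conic_def by blast
  qed
  show "?R \<subseteq> conic" by (auto simp: conic_def inner_add_left)
qed

lemma line_point: "p + t *\<^sub>R e \<in> conic \<longleftrightarrow> quad e * t\<^sup>2 + 2 * polar p e * t + val p = 0"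
proof -
  have "p + t *\<^sub>R e - c = (p - c) + t *\<^sub>R e" by simp
  then have "val (p + t *\<^sub>R e) = quad e * t\<^sup>2 + 2 * polar p e * t + val p"
    using mu nu unfolding val_def quad_def polar_def
    by (simp only: inner_add_left inner_scaleR_left) (simp add: field_simps power2_eq_square)
  then show ?thesis by (simp add: conic_iff)
qed

lemma dual_quad: "dual e = \<mu> * \<nu> * quad e"
  using mu nu by (simp add: dual_def quad_def field_simps)

text \<open>Lagrange's identity for the form \<open>quad\<close> gives the determinant term, and the
  \<open>- 1\<close> in \<open>val\<close> contributes \<open>dual e\<close>. Hence the equation
  restricted to a line has discriminant zero exactly if
  \<open>dual e = (det2 e (p - c))\<^sup>2\<close>.\<close>

lemma discriminant:
  "\<mu> * \<nu> * ((polar p e)\<^sup>2 - quad e * val p) = dual e - (det2 e (p - c))\<^sup>2"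
proof -
  have "\<mu> * \<nu> * ((polar p e)\<^sup>2 - quad e * val p) =
    dual e - ((e \<bullet> u) * ((p - c) \<bullet> v) - (e \<bullet> v) * ((p - c) \<bullet> u))\<^sup>2"
    using mu nu unfolding val_def quad_def polar_def dual_def
    by (simp add: field_simps power2_eq_square)
  then show ?thesis by (simp add: orthonormal_pair_cross[OF uv])
qed

text \<open>Here the restricted equation is constant. By \<open>discriminant\<close> the line passes
  through \<open>c\<close>, so the constant is \<open>val c\<close>; such a line misses the
  conic.\<close>

lemma val_of_isotropic:
  assumes "e \<noteq> 0" "quad e = 0" "polar p e = 0"
  shows "val p = -1"
proof -
  have "det2 e (p - c) = 0"
    using discriminant[of p e] assms by (simp add: dual_quad)
  with assms(1) obtain k where "p - c = k *\<^sub>R e" by (auto simp: det2_eq_0_iff)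
  then have "quad (p - c) = k\<^sup>2 * quad e" using mu nu by (simp add: quad_def field_simps)
  with assms(2) show ?thesis by (simp add: val_def)
qed

lemma polar_zero:
  assumes "quad e = 0" "e \<noteq> 0" "p \<in> conic"
  shows "polar p e \<noteq> 0"
  using val_of_isotropic[of e p] assms by (auto simp: conic_iff)

text \<open>A quadratic polynomial with roots 0, 1 and 2 vanishes identically, which
  \<open>polar_zero\<close> forbids in a nonzero direction.\<close>

lemma three_points:
  assumes "p \<in> conic" "p + e \<in> conic" "p + 2 *\<^sub>R e \<in> conic"
  shows "e = 0"
proof (rule ccontr)
  assume e: "e \<noteq> 0"
  have "quad e * 1\<^sup>2 + 2 * polar p e * 1 + val p = 0" "quad e * 2\<^sup>2 + 2 * polar p e * 2 + val p = 0"
    using assms line_point[of p 1 e] line_point[of p 2 e] by simp_all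
  with assms(1) have "quad e = 0" "polar p e = 0" by (simp_all add: conic_iff)
  with polar_zero e assms(1) show False by blast
qed

lemma center: "is_center c conic"
proof -
  have "val (2 *\<^sub>R c - x) = val x" for x
  proof -
    have "2 *\<^sub>R c - x - c = - (x - c)" by (simp add: scaleR_2)
    then show ?thesis unfolding val_def quad_def by (simp only: inner_minus_left) simp
  qed
  then show ?thesis by (simp add: is_center_def conic_iff)
qed

text \<open>Reflection in \<open>c\<close> followed by reflection in \<open>z\<close> is a
  translation, and iterating it would give three equally spaced points of the conic on a line. If
  both coefficients are negative, the conic is empty and every point is a center, hence the first
  assumption.\<close>

lemma center_unique:
  assumes "conic \<noteq> {}" "is_center z conic"
  shows "z = c"
proof -
  define e where "e = 2 *\<^sub>R (z - c)"
  have step: "p + e \<in> conic" if "p \<in> conic" for p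
  proof -
    have "2 *\<^sub>R z - (2 *\<^sub>R c - p) \<in> conic"
      using that center assms(2) unfolding is_center_def by blast
    moreover have "2 *\<^sub>R z - (2 *\<^sub>R c - p) = p + e" by (simp add: e_def algebra_simps)
    ultimately show ?thesis by simp
  qed
  from assms(1) obtain p where p: "p \<in> conic" by blast
  have "p + 2 *\<^sub>R e \<in> conic"
    using step[OF step[OF p]] by (simp add: scaleR_2 add.assoc)
  then have "e = 0" using three_points[of p e] p step by blast
  then show ?thesis by (simp add: e_def)
qed

end

text \<open>Up to exchanging the axes, positivity of \<open>\<mu>\<close> excludes only the empty
  conic. The sign of \<open>\<nu>\<close> separates ellipses from hyperbolas.\<close>

locale ellipse_or_hyperbola = central_conic +
  assumes mu_pos: "\<mu> > 0"
begin

lemma vertex_mem: "c + sqrt \<mu> *\<^sub>R u \<in> conic"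
  using mu_pos by (simp add: conic_def)

text \<open>In an isotropic direction the restricted equation is linear with nonzero slope. In any
  other direction a conic point is met only once if its polar with \<open>e\<close> vanishes, and
  this cannot happen at all points of the conic.\<close>

lemma once_direction_iff:
  assumes "e \<noteq> 0"
  shows "once_direction conic e \<longleftrightarrow> quad e = 0"
proof
  assume q: "quad e = 0"
  show "once_direction conic e"
    unfolding once_direction_def
  proof (intro ballI allI impI)
    fix p t assume "p \<in> conic" "p + t *\<^sub>R e \<in> conic"
    then have "val p = 0" "quad e * t\<^sup>2 + 2 * polar p e * t + val p = 0"
      by (auto simp only: conic_iff[of p] line_point[of p])
    then have "polar p e * t = 0" using q by simp
    with polar_zero[OF q assms \<open>p \<in> conic\<close>] show "t = 0" by simp
  qed
next
  assume d: "once_direction conic e"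
  show "quad e = 0"
  proof (rule ccontr)
    assume q: "quad e \<noteq> 0"
    have polar0: "polar p e = 0" if "p \<in> conic" for p
    proof -
      \<comment> \<open>The second root of the restricted equation, the first being 0.\<close>
      have "p + (- 2 * polar p e / quad e) *\<^sub>R e \<in> conic"
        using that[unfolded conic_iff] q unfolding line_point by (simp add: power2_eq_square)
      with d that have "- 2 * polar p e / quad e = 0" unfolding once_direction_def by blast
      with q show ?thesis by simp
    qed
    have eu: "e \<bullet> u = 0"
      using polar0[OF vertex_mem] mu_pos by (simp add: polar_def)
    have "e \<bullet> v = 0"
    proof (cases "\<nu> > 0")
      case True
      then have "c + sqrt \<nu> *\<^sub>R v \<in> conic" by (simp add: conic_def)
      from polar0[OF this] True show ?thesis by (simp add: polar_def)
    next
      case False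
      \<comment> \<open>A hyperbola has no vertex on the axis along \<open>v\<close>; this point
        satisfies its equation as 2 - 1 = 1.\<close>
      then have "c + sqrt (2 * \<mu>) *\<^sub>R u + sqrt (- \<nu>) *\<^sub>R v \<in> conic"
        using mu_pos nu by (simp add: conic_def inner_add_left)
      from polar0[OF this] eu False nu show ?thesis by (simp add: polar_def inner_add_left)
    qed
    with eu have "e = 0" using orthonormal_pair_expand[OF uv, of e] by simp
    with assms show False by simp
  qed
qed

end

section \<open>Asymptotes and lines directed along a conic\<close>

lemma std_hyperbola_central:
  assumes "orthonormal_pair u v" "a > 0" "b > 0"
  shows "ellipse_or_hyperbola u v (a\<^sup>2) (- b\<^sup>2)"
    and "std_hyperbola c u v a b = central_conic.conic c u v (a\<^sup>2) (- b\<^sup>2)"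
proof -
  show "ellipse_or_hyperbola u v (a\<^sup>2) (- b\<^sup>2)" using assms by unfold_locales auto
  then interpret ellipse_or_hyperbola c u v "a\<^sup>2" "- b\<^sup>2" .
  show "std_hyperbola c u v a b = conic" by (simp add: conic_alt std_hyperbola_def)
qed

text \<open>The canonical equation hidden in \<open>is_asymptote\<close> may differ from the one at
  hand, so only properties of the set \<open>H\<close> are kept. On an asymptote, parametrized from
  the center, the equation of the conic reads \<open>-1 = 0\<close>.\<close>

lemma is_asymptoteE:
  assumes "is_asymptote L H"
  obtains c e where "e \<noteq> 0" "L = line_through c (c + e)" "once_direction H e" "L \<inter> H = {}"
proof -
  from assms obtain c u v a b where h: "orthonormal_pair u v" "a > 0" "b > 0" 
    "H = std_hyperbola c u v a b"
    and L: "L = line_through c (c + a *\<^sub>R u + b *\<^sub>R v) \<or> L = line_through c (c + a *\<^sub>R u - b *\<^sub>R v)"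
    unfolding is_asymptote_def by blast
  interpret ellipse_or_hyperbola c u v "a\<^sup>2" "- b\<^sup>2" by (rule std_hyperbola_central(1)[OF h(1-3)])
  have H: "H = conic" using h std_hyperbola_central(2) by blast
  from L obtain \<sigma> :: real where s: "\<sigma>\<^sup>2 = 1" and L: "L = line_through c (c + (a *\<^sub>R u + (\<sigma> * b) *\<^sub>R v))"
  proof
    assume "L = line_through c (c + a *\<^sub>R u + b *\<^sub>R v)" then show ?thesis using that[of 1] by (simp add: add.assoc)
  next
    assume "L = line_through c (c + a *\<^sub>R u - b *\<^sub>R v)" then show ?thesis using that[of "-1"] by (simp add: algebra_simps)
  qed
  define e where "e = a *\<^sub>R u + (\<sigma> * b) *\<^sub>R v"
  have eu: "e \<bullet> u = a" "e \<bullet> v = \<sigma> * b" by (simp_all add: e_def inner_add_left)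
  with h have e0: "e \<noteq> 0" by auto
  have q: "quad e = 0" using h s by (simp add: quad_def eu power_mult_distrib)
  have "polar c e = 0" "val c = -1" by (simp_all add: polar_def val_def quad_def)
  then have "c + t *\<^sub>R e \<notin> conic" for t unfolding line_point q by simp
  then have "L \<inter> H = {}" by (auto simp: L H line_through_eq e_def[symmetric])
  moreover have "once_direction H e" using once_direction_iff[OF e0] q H by simp
  moreover have "L = line_through c (c + e)" unfolding L e_def by (rule refl)
  ultimately show ?thesis using e0 that by blast
qed

text \<open>Parabola axes are treated together with asymptotes, which avoids proving that a central
  conic is no parabola: for it, \<open>once_direction_iff\<close> turns the conclusion into
  isotropy.\<close>

lemma directed_along_once:
  assumes "directed_along (line_through p q) H" "p \<noteq> q"
  shows "once_direction H (q - p)"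
proof -
  consider A where "is_asymptote A H" "affine_parallel (line_through p q) A"
    | A where "is_parabola_axis A H" "affine_parallel (line_through p q) A"
    using assms unfolding directed_along_def by blast
  then show ?thesis
  proof cases
    case 1
    from is_asymptoteE[OF 1(1)] obtain c e where "e \<noteq> 0" "A = line_through c (c + e)" "once_direction H e"
      by metis
    with 1 assms(2) once_direction_parallel show ?thesis by metis
  next
    case 2
    then obtain c u v a where h: "orthonormal_pair u v" "H = std_parabola c u v a" "A = line_through c (c + v)"
      unfolding is_parabola_axis_def by blast
    have uv [simp]: "u \<bullet> u = 1" "v \<bullet> v = 1" "u \<bullet> v = 0" "v \<bullet> u = 0"
      using h by (auto simp: orthonormal_pair_def norm_eq_1 inner_commute)
    \<comment> \<open>A shift along \<open>v\<close> changes only the left side of this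
      equation.\<close>
    have mem: "(x - c) \<bullet> v = a * ((x - c) \<bullet> u)\<^sup>2" if "x \<in> H" for x
      using that h(2) by (auto simp: std_parabola_def inner_add_left)
    have "once_direction H v"
      unfolding once_direction_def
    proof (intro ballI allI impI)
      fix x t assume "x \<in> H" "x + t *\<^sub>R v \<in> H"
      from mem[OF this(1)] mem[OF this(2)] show "t = 0" by (simp add: algebra_simps)
    qed
    moreover have "v \<noteq> 0" using uv by force
    ultimately show ?thesis using once_direction_parallel 2 h(3) assms(2) by metis
  qed
qed

section \<open>The tangency criterion in terms of the dual form\<close>

lemma unique_quadratic_root:
  fixes K M N :: real
  assumes "K \<noteq> 0"
  shows "(\<exists>!t. K * t\<^sup>2 + 2 * M * t + N = 0) \<longleftrightarrow> M\<^sup>2 = K * N"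
proof -
  have *: "K * t\<^sup>2 + 2 * M * t + N = 0 \<longleftrightarrow> (K * t + M)\<^sup>2 = M\<^sup>2 - K * N" for t
  proof -
    have "(K * t + M)\<^sup>2 - (M\<^sup>2 - K * N) = K * (K * t\<^sup>2 + 2 * M * t + N)" by algebra
    with assms show ?thesis by auto
  qed
  show ?thesis
  proof
    assume "\<exists>!t. K * t\<^sup>2 + 2 * M * t + N = 0"
    then obtain t where t: "(K * t + M)\<^sup>2 = M\<^sup>2 - K * N" and
      un: "\<And>s. (K * s + M)\<^sup>2 = M\<^sup>2 - K * N \<Longrightarrow> s = t"
      unfolding * by blast
    \<comment> \<open>By Vieta, \<open>- t - 2 * M / K\<close> is the other root; uniqueness makes
      it equal to \<open>t\<close>.\<close>
    have "K * (- t - 2 * M / K) + M = - (K * t + M)" using assms by (simp add: field_simps)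
    with t have "- t - 2 * M / K = t" by (intro un) (simp only: power2_minus)
    with assms have "K * t + M = 0" by (simp add: field_simps)
    with t show "M\<^sup>2 = K * N" by simp
  next
    assume "M\<^sup>2 = K * N"
    then show "\<exists>!t. K * t\<^sup>2 + 2 * M * t + N = 0"
      unfolding * using assms by (intro ex1I[of _ "- M / K"]) (auto simp: field_simps)
  qed
qed

lemma ex1_mem_line_through:
  assumes "p \<noteq> q"
  shows "(\<exists>!x. x \<in> line_through p q \<inter> H) \<longleftrightarrow> (\<exists>!t. p + t *\<^sub>R (q - p) \<in> H)"
proof -
  have inj: "inj (\<lambda>t. p + t *\<^sub>R (q - p))" using assms by (auto intro: injI)
  have range: "line_through p q = range (\<lambda>t. p + t *\<^sub>R (q - p))" by (auto simp: line_through_eq)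
  show ?thesis
  proof
    assume "\<exists>!x. x \<in> line_through p q \<inter> H"
    then obtain t where "p + t *\<^sub>R (q - p) \<in> H" 
      and "\<And>s. p + s *\<^sub>R (q - p) \<in> H \<Longrightarrow> p + s *\<^sub>R (q - p) = p + t *\<^sub>R (q - p)"
      unfolding range by blast
    then show "\<exists>!t. p + t *\<^sub>R (q - p) \<in> H" using injD[OF inj] by blast
  next
    assume "\<exists>!t. p + t *\<^sub>R (q - p) \<in> H"
    then show "\<exists>!x. x \<in> line_through p q \<inter> H" unfolding range by blast
  qed
qed

context ellipse_or_hyperbola
begin

text \<open>A nonzero isotropic vector forces \<open>\<nu> < 0\<close>; then \<open>quad\<close> is
  a difference of two squares, and \<open>e\<close> is a multiple of \<open>a u + b v\<close> or
  \<open>a u - b v\<close>.\<close>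

lemma asymptote_of_isotropic:
  assumes "e \<noteq> 0" "quad e = 0"
  shows "is_asymptote (line_through c (c + e)) conic"
proof -
  have nneg: "\<nu> < 0"
  proof (rule ccontr)
    assume "\<not> \<nu> < 0"
    with nu have "\<nu> > 0" by simp
    with mu_pos assms(2) have "(e \<bullet> u)\<^sup>2 / \<mu> = 0 \<and> (e \<bullet> v)\<^sup>2 / \<nu> = 0"
      unfolding quad_def by (subst add_nonneg_eq_0_iff[symmetric]) auto
    with mu nu have "e \<bullet> u = 0" "e \<bullet> v = 0" by auto
    with assms(1) orthonormal_pair_expand[OF uv, of e] show False by simp
  qed
  define a b where "a = sqrt \<mu>" and "b = sqrt (- \<nu>)"
  have ab: "a > 0" "b > 0" "a\<^sup>2 = \<mu>" "b\<^sup>2 = - \<nu>" using mu_pos nneg by (auto simp: a_def b_def)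
  have H: "conic = std_hyperbola c u v a b"
    unfolding std_hyperbola_def conic_alt ab by simp
  have "(b * (e \<bullet> u))\<^sup>2 = (a * (e \<bullet> v))\<^sup>2"
    using assms(2) mu nu by (simp add: quad_def ab field_simps)
  then consider "b * (e \<bullet> u) = a * (e \<bullet> v)" | "b * (e \<bullet> u) = - (a * (e \<bullet> v))"
    using power2_eq_iff by blast
  then obtain \<sigma> :: real where s: "\<sigma> = 1 \<or> \<sigma> = -1" "e \<bullet> v = \<sigma> * b * (e \<bullet> u) / a"
  proof cases
    case 1
    with ab(1) that[of 1] show ?thesis by (simp add: field_simps)
  next
    case 2
    with ab(1) that[of "-1"] show ?thesis by (simp add: field_simps)
  qed
  define k where "k = (e \<bullet> u) / a"
  have e: "e = k *\<^sub>R (a *\<^sub>R u + (\<sigma> * b) *\<^sub>R v)"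
    using orthonormal_pair_expand[OF uv, of e] s(2) ab(1) by (simp add: k_def algebra_simps)
  with assms(1) have "k \<noteq> 0" by auto
  define w where "w = a *\<^sub>R u + (\<sigma> * b) *\<^sub>R v"
  have "w \<noteq> 0" using assms(1) e w_def by auto
  have "line_through c (c + e) = line_through c (c + w)"
  proof (rule set_eqI)
    fix x
    have "det2 e (x - c) = k * det2 w (x - c)"
      unfolding e[folded w_def] det2_def by (simp add: algebra_simps)
    with \<open>k \<noteq> 0\<close> show "x \<in> line_through c (c + e) \<longleftrightarrow> x \<in> line_through c (c + w)"
      using assms(1) \<open>w \<noteq> 0\<close> by (simp add: mem_line_through_iff)
  qed
  moreover have "c + w = c + a *\<^sub>R u + b *\<^sub>R v \<or> c + w = c + a *\<^sub>R u - b *\<^sub>R v"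
    using s(1) by (auto simp: w_def)
  ultimately show ?thesis using ab(1,2) uv H unfolding is_asymptote_def by metis
qed

text \<open>In a direction that is not isotropic, tangency means a double root. In an isotropic one
  the line is directed along the conic, so only an asymptote qualifies. In both cases the condition
  is that the discriminant vanishes.\<close>

lemma tangent_to_iff:
  assumes "p \<noteq> q"
  shows "tangent_to (line_through p q) conic \<longleftrightarrow> dual (q - p) = (det2 (q - p) (p - c))\<^sup>2"
proof -
  define e where "e = q - p"
  have e: "e \<noteq> 0" using assms by (simp add: e_def)
  have disc: "dual e = (det2 e (p - c))\<^sup>2 \<longleftrightarrow> (polar p e)\<^sup>2 = quad e * val p"
    using discriminant[of p e] mu nu by auto
  have ex1: "(\<exists>!x. x \<in> line_through p q \<inter> conic) \<longleftrightarrow> (polar p e)\<^sup>2 = quad e * val p" if "quad e \<noteq> 0"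
    unfolding ex1_mem_line_through[OF assms] line_point e_def[symmetric]
    by (rule unique_quadratic_root[OF that])
  have directed: "directed_along (line_through p q) conic \<longleftrightarrow> quad e = 0"
  proof
    assume "directed_along (line_through p q) conic"
    from directed_along_once[OF this assms] show "quad e = 0"
      using once_direction_iff[OF e] by (simp add: e_def)
  next
    assume q0: "quad e = 0"
    have "affine_parallel (line_through p q) (line_through c (c + e))"
      using assms e by (subst affine_parallel_iff_det2) (auto simp: e_def det2_def)
    with asymptote_of_isotropic[OF e q0] show "directed_along (line_through p q) conic"
      unfolding directed_along_def by blast
  qed
  have asym: "is_asymptote (line_through p q) conic \<longleftrightarrow> quad e = 0 \<and> polar p e = 0"
  proof
    assume a: "is_asymptote (line_through p q) conic"
    have "affine_parallel (line_through p q) (line_through p q)"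
      using assms by (subst affine_parallel_iff_det2) (auto simp: det2_def)
    with a have q0: "quad e = 0" using directed unfolding directed_along_def by blast
    have "polar p e = 0"
    proof (rule ccontr)
      \<comment> \<open>Otherwise the restricted equation is linear and solvable, but an asymptote
        misses the conic.\<close>
      assume "polar p e \<noteq> 0"
      then have "p + (- val p / (2 * polar p e)) *\<^sub>R e \<in> conic"
        unfolding line_point q0 by simp
      moreover have "p + (- val p / (2 * polar p e)) *\<^sub>R e \<in> line_through p q"
        unfolding line_through_eq e_def by blast
      ultimately show False using is_asymptoteE[OF a] by blast
    qed
    with q0 show "quad e = 0 \<and> polar p e = 0" by simp
  next
    assume q0: "quad e = 0 \<and> polar p e = 0"
    then have "(det2 e (p - c))\<^sup>2 = 0" using disc by (simp add: dual_quad)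
    then have "det2 e (p - c) = 0" by simp
    then have "line_through p q = line_through c (c + e)"
    proof (intro set_eqI)
      fix x
      have "det2 e (x - c) = det2 e (x - p) + det2 e (p - c)"
        by (simp add: det2_def algebra_simps)
      with \<open>det2 e (p - c) = 0\<close> show "x \<in> line_through p q \<longleftrightarrow> x \<in> line_through c (c + e)"
        using assms e by (simp add: mem_line_through_iff e_def)
    qed
    with asymptote_of_isotropic[OF e] q0 show "is_asymptote (line_through p q) conic" by simp
  qed
  show ?thesis
  proof (cases "quad e = 0")
    case True
    then show ?thesis unfolding tangent_to_def directed asym e_def[symmetric] disc by simp
  next
    case False
    then show ?thesis
      unfolding tangent_to_def directed asym e_def[symmetric] disc ex1[OF False] by simp
  qed
qed

end

section \<open>Tangent conics as solutions of linear equations for a quadratic form\<close>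

lemma center_of_tangent_conic_iff_central:
  "center_of_tangent_conic S c \<longleftrightarrow>
    (\<exists>u v \<mu> \<nu>. ellipse_or_hyperbola u v \<mu> \<nu> \<and> (\<forall>L\<in>S. tangent_to L (central_conic.conic c u v \<mu> \<nu>)))"
proof
  assume "center_of_tangent_conic S c"
  then obtain H where H: "is_ellipse H \<or> is_hyperbola H" "is_center c H" "\<forall>L\<in>S. tangent_to L H"
    unfolding center_of_tangent_conic_def by blast
  obtain c' u v \<mu> \<nu> where 1: "ellipse_or_hyperbola u v \<mu> \<nu>" "H = central_conic.conic c' u v \<mu> \<nu>"
    using H(1)
  proof
    assume "is_hyperbola H"
    with that std_hyperbola_central show ?thesis
      unfolding is_hyperbola_def by metis
  next
    assume "is_ellipse H"
    then obtain c' u v a b where h: "orthonormal_pair u v" "a > 0" "b > 0"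
       "H = {c' + x *\<^sub>R u + y *\<^sub>R v | x y. x\<^sup>2 / a\<^sup>2 + y\<^sup>2 / b\<^sup>2 = 1}"
      unfolding is_ellipse_def by blast
    interpret ellipse_or_hyperbola c' u v "a\<^sup>2" "b\<^sup>2" using h by unfold_locales auto
    show ?thesis using that conic_alt h(4) ellipse_or_hyperbola_axioms by metis
  qed
  interpret ellipse_or_hyperbola c' u v \<mu> \<nu> by (rule 1)
  \<comment> \<open>The conic was given by some canonical equation, whose origin now turns out to be
    the prescribed center.\<close>
  have "c = c'" using center_unique vertex_mem H(2) 1(2) by blast
  with 1 H(3) show "\<exists>u v \<mu> \<nu>. ellipse_or_hyperbola u v \<mu> \<nu> \<and> (\<forall>L\<in>S. tangent_to L (central_conic.conic c u v \<mu> \<nu>))"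
    by blast
next
  assume "\<exists>u v \<mu> \<nu>. ellipse_or_hyperbola u v \<mu> \<nu> \<and> (\<forall>L\<in>S. tangent_to L (central_conic.conic c u v \<mu> \<nu>))"
  then obtain u v \<mu> \<nu> where 1: "ellipse_or_hyperbola u v \<mu> \<nu>" 
    and t: "\<forall>L\<in>S. tangent_to L (central_conic.conic c u v \<mu> \<nu>)" by blast
  interpret ellipse_or_hyperbola c u v \<mu> \<nu> by (rule 1)
  have "is_ellipse conic \<or> is_hyperbola conic"
  proof (cases "\<nu> > 0")
    case True
    then have "is_ellipse conic"
      unfolding is_ellipse_def conic_alt using uv mu_pos
      by (intro exI[of _ c] exI[of _ u] exI[of _ v] exI[of _ "sqrt \<mu>"] exI[of _ "sqrt \<nu>"]) simp
    then show ?thesis ..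
  next
    case False
    then have "is_hyperbola conic"
      unfolding is_hyperbola_def std_hyperbola_def conic_alt using uv mu_pos nu
      by (intro exI[of _ c] exI[of _ u] exI[of _ v] exI[of _ "sqrt \<mu>"] exI[of _ "sqrt (-\<nu>)"]) simp
    then show ?thesis ..
  qed
  with center t show "center_of_tangent_conic S c" unfolding center_of_tangent_conic_def by blast
qed

text \<open>Diagonalization by a rotation. A nonnegative value at a nonzero vector rules out a
  negative definite form, so the larger eigenvalue \<open>\<mu>\<close> is positive. The
  eigenvectors are paired with the eigenvalues as in \<open>dual\<close>.\<close>

lemma spectral2:
  fixes A B C :: real and e0 :: plane
  assumes "A * C - B\<^sup>2 \<noteq> 0" and e0: "e0 \<noteq> 0" "A * (e0 $ 1)\<^sup>2 + 2 * B * e0 $ 1 * e0 $ 2 + C * (e0 $ 2)\<^sup>2 \<ge> 0"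
  obtains u v \<mu> \<nu> where "orthonormal_pair u v" "\<mu> > 0" "\<nu> \<noteq> 0"
    "\<And>e :: plane. A * (e $ 1)\<^sup>2 + 2 * B * e $ 1 * e $ 2 + C * (e $ 2)\<^sup>2 = \<mu> * (e \<bullet> v)\<^sup>2 + \<nu> * (e \<bullet> u)\<^sup>2"
proof -
  define R where "R = sqrt (((A - C) / 2)\<^sup>2 + B\<^sup>2)"
  have R2: "R\<^sup>2 = ((A - C) / 2)\<^sup>2 + B\<^sup>2" by (simp add: R_def)
  have R0: "R \<ge> 0" by (simp add: R_def)
  \<comment> \<open>Polar coordinates of \<open>((A - C) / 2, B)\<close>; the principal axes are
    turned by half of this angle.\<close>
  obtain \<phi> where \<phi>: "R * cos \<phi> = (A - C) / 2" "R * sin \<phi> = B"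
  proof (cases "R = 0")
    case True
    then have "((A - C) / 2)\<^sup>2 + B\<^sup>2 = 0" using R2 by simp
    then have "(A - C) / 2 = 0 \<and> B = 0" by (simp only: sum_power2_eq_zero_iff)
    with True that[of 0] show ?thesis by simp
  next
    case False
    have "(((A - C) / 2) / R)\<^sup>2 + (B / R)\<^sup>2 = (((A - C) / 2)\<^sup>2 + B\<^sup>2) / R\<^sup>2"
      unfolding power_divide add_divide_distrib by (rule refl)
    also have "\<dots> = 1" unfolding R2[symmetric] using False by simp
    finally have "(((A - C) / 2) / R)\<^sup>2 + (B / R)\<^sup>2 = 1" .
    from sincos_total_2pi[OF this] obtain t where "(A - C) / 2 / R = cos t" "B / R = sin t" by metis
    with False that[of t] show ?thesis by (simp add: field_simps)
  qed
  define \<theta> where "\<theta> = \<phi> / 2"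
  have \<phi>2: "\<phi> = 2 * \<theta>" by (simp add: \<theta>_def)
  have cs: "(cos \<theta>)\<^sup>2 + (sin \<theta>)\<^sup>2 = 1" by simp
  have dbl: "R * ((cos \<theta>)\<^sup>2 - (sin \<theta>)\<^sup>2) = (A - C) / 2" "R * (2 * sin \<theta> * cos \<theta>) = B"
    using \<phi> by (simp_all add: \<phi>2 cos_double sin_double)
  define \<mu> \<nu> where "\<mu> = (A + C) / 2 + R" and "\<nu> = (A + C) / 2 - R"
  define v u :: plane where "v = vector [cos \<theta>, sin \<theta>]" and "u = vector [- sin \<theta>, cos \<theta>]"
  have form: "A * (e $ 1)\<^sup>2 + 2 * B * e $ 1 * e $ 2 + C * (e $ 2)\<^sup>2 = \<mu> * (e \<bullet> v)\<^sup>2 + \<nu> * (e \<bullet> u)\<^sup>2" for e :: plane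
  proof -
    have "\<mu> * (e \<bullet> v)\<^sup>2 + \<nu> * (e \<bullet> u)\<^sup>2 = (A + C) / 2 * ((cos \<theta>)\<^sup>2 + (sin \<theta>)\<^sup>2) * ((e $ 1)\<^sup>2 + (e $ 2)\<^sup>2)
      + R * ((cos \<theta>)\<^sup>2 - (sin \<theta>)\<^sup>2) * ((e $ 1)\<^sup>2 - (e $ 2)\<^sup>2) + 2 * (R * (2 * sin \<theta> * cos \<theta>)) * e $ 1 * e $ 2"
      unfolding \<mu>_def \<nu>_def inner_plane v_def u_def vector_2 by algebra
    also have "\<dots> = A * (e $ 1)\<^sup>2 + 2 * B * e $ 1 * e $ 2 + C * (e $ 2)\<^sup>2"
      unfolding cs dbl by (simp add: field_simps)
    finally show ?thesis ..
  qed
  have "\<mu> * \<nu> = A * C - B\<^sup>2"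
    using R2 unfolding \<mu>_def \<nu>_def by (simp add: field_simps power2_eq_square)
  with assms(1) have nz: "\<mu> \<noteq> 0" "\<nu> \<noteq> 0" by auto
  have on: "orthonormal_pair u v"
    by (simp add: orthonormal_pair_def norm_eq_1 inner_plane u_def v_def power2_eq_square[symmetric])
  have "\<mu> > 0"
  proof (rule ccontr)
    assume "\<not> \<mu> > 0"
    with nz have "\<mu> < 0" by simp
    moreover have "\<nu> \<le> \<mu>" using R0 by (simp add: \<mu>_def \<nu>_def)
    ultimately have neg: "\<mu> < 0" "\<nu> < 0" by simp_all
    have le: "\<mu> * (e0 \<bullet> v)\<^sup>2 \<le> 0" "\<nu> * (e0 \<bullet> u)\<^sup>2 \<le> 0" using neg by (auto intro: mult_nonpos_nonneg)
    with e0(2) have "\<mu> * (e0 \<bullet> v)\<^sup>2 = 0" "\<nu> * (e0 \<bullet> u)\<^sup>2 = 0"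
      unfolding form by linarith+
    with nz have "e0 \<bullet> v = 0" "e0 \<bullet> u = 0" by auto
    with orthonormal_pair_expand[OF on, of e0] e0(1) show False by simp
  qed
  with that on nz form show thesis by blast
qed

text \<open>By \<open>tangent_to_iff\<close> the dual form must take prescribed values on the
  directions of the lines. Conversely \<open>spectral2\<close> turns any nondegenerate form with
  these values into an ellipse or hyperbola.\<close>

lemma center_of_tangent_conic_iff:
  assumes "S \<noteq> {}" and "\<And>p q. (p, q) \<in> S \<Longrightarrow> p \<noteq> q"
  shows "center_of_tangent_conic ((\<lambda>(p, q). line_through p q) ` S) c \<longleftrightarrow>
    (\<exists>A B C. A * C - B\<^sup>2 \<noteq> 0 \<and> (\<forall>(p, q)\<in>S.
       A * ((q - p) $ 1)\<^sup>2 + 2 * B * (q - p) $ 1 * (q - p) $ 2 + C * ((q - p) $ 2)\<^sup>2 =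
       (det2 (q - p) (p - c))\<^sup>2))"
    (is "?L \<longleftrightarrow> ?R")
proof
  assume ?L
  then obtain u v \<mu> \<nu> where 1: "ellipse_or_hyperbola u v \<mu> \<nu>" 
    and t: "\<forall>(p, q)\<in>S. tangent_to (line_through p q) (central_conic.conic c u v \<mu> \<nu>)"
    unfolding center_of_tangent_conic_iff_central by fastforce
  interpret ellipse_or_hyperbola c u v \<mu> \<nu> by (rule 1)
  \<comment> \<open>The coefficients of \<open>dual\<close> in standard coordinates.\<close>
  define A B C where "A = \<mu> * (v $ 1)\<^sup>2 + \<nu> * (u $ 1)\<^sup>2" and "B = \<mu> * v $ 1 * v $ 2 + \<nu> * u $ 1 * u $ 2"
    and "C = \<mu> * (v $ 2)\<^sup>2 + \<nu> * (u $ 2)\<^sup>2"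
  have det: "A * C - B\<^sup>2 = \<mu> * \<nu> * (det2 u v)\<^sup>2" unfolding A_def B_def C_def det2_def by algebra
  have nz: "A * C - B\<^sup>2 \<noteq> 0" unfolding det using mu nu orthonormal_pair_det2[OF uv] by simp
  have form: "A * (e $ 1)\<^sup>2 + 2 * B * e $ 1 * e $ 2 + C * (e $ 2)\<^sup>2 = dual e" for e
    unfolding A_def B_def C_def dual_def inner_plane by algebra
  have "\<forall>(p, q)\<in>S. dual (q - p) = (det2 (q - p) (p - c))\<^sup>2"
    using t tangent_to_iff assms(2) by blast
  with nz show ?R unfolding form[symmetric] by blast
next
  assume ?R
  then obtain A B C where n: "A * C - B\<^sup>2 \<noteq> 0" and t: "\<And>p q. (p, q) \<in> S \<Longrightarrow>
       A * ((q - p) $ 1)\<^sup>2 + 2 * B * (q - p) $ 1 * (q - p) $ 2 + C * ((q - p) $ 2)\<^sup>2 =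
       (det2 (q - p) (p - c))\<^sup>2" by blast
  \<comment> \<open>One line suffices to exclude negative definite forms, since the value there is a
    square.\<close>
  from assms obtain p q where pq: "(p, q) \<in> S" "q - p \<noteq> 0" by fastforce
  obtain u v \<mu> \<nu> where 1: "orthonormal_pair u v" "\<mu> > 0" "\<nu> \<noteq> 0" and
    f: "\<And>e :: plane. A * (e $ 1)\<^sup>2 + 2 * B * e $ 1 * e $ 2 + C * (e $ 2)\<^sup>2 = \<mu> * (e \<bullet> v)\<^sup>2 + \<nu> * (e \<bullet> u)\<^sup>2"
    using spectral2[OF n pq(2)] t[OF pq(1)] by (metis zero_le_power2)
  interpret ellipse_or_hyperbola c u v \<mu> \<nu> using 1 by unfold_locales auto
  have "tangent_to (line_through p q) conic" if "(p, q) \<in> S" for p q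
    using tangent_to_iff[OF assms(2)[OF that]] t[OF that]
    unfolding dual_def f[symmetric] by blast
  then have "\<forall>L\<in>(\<lambda>(p, q). line_through p q) ` S. tangent_to L conic" by auto
  then show ?L using ellipse_or_hyperbola_axioms unfolding center_of_tangent_conic_iff_central by blast
qed


section \<open>The tangency equations\<close>

text \<open>Tangency of the conic with centre \<open>(p, r)\<close> and dual form \<open>(A, B, C)\<close> to the sides of the
  quadrilateral \<open>(0, 0), (1, 0), (0, 1), (s, t)\<close>.\<close>

definition tangent_system :: "real \<Rightarrow> real \<Rightarrow> real \<Rightarrow> real \<Rightarrow> real \<Rightarrow> real \<Rightarrow> real \<Rightarrow> bool" where
  "tangent_system s t p r A B C \<longleftrightarrow>
     A = r\<^sup>2 \<and>
     A - 2 * B + C = (p + r - 1)\<^sup>2 \<and>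
     s\<^sup>2 * A + 2 * s * (t - 1) * B + (t - 1)\<^sup>2 * C = (s * (1 - r) + (t - 1) * p)\<^sup>2 \<and>
     s\<^sup>2 * A + 2 * s * t * B + t\<^sup>2 * C = (t * p - s * r)\<^sup>2"

text \<open>Subtracting the degenerate solution \<open>A = r\<^sup>2\<close>, \<open>B = - p r\<close>, \<open>C = p\<^sup>2\<close> of the first and last
  equations makes the system linear in \<open>p\<close> and \<open>r\<close>.\<close>

lemma tangent_system_reduced:
  assumes "s \<noteq> 0" "t \<noteq> 0"
  shows "tangent_system s t p r A B C \<longleftrightarrow>
    (\<exists>\<beta> \<gamma>. A = r\<^sup>2 \<and> B = \<beta> - p * r \<and> C = p\<^sup>2 + \<gamma> \<and> t * \<gamma> + 2 * s * \<beta> = 0 \<and>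
      \<gamma> - 2 * \<beta> = 1 - 2 * (p + r) \<and> (1 - t) * \<gamma> = s * (2 * ((t - 1) * p - s * r) + s))"
    (is "_ \<longleftrightarrow> ?R")
proof -
  define \<beta> \<gamma> where "\<beta> = B + p * r" and "\<gamma> = C - p\<^sup>2"
  have B: "B = \<beta> - p * r" and C: "C = p\<^sup>2 + \<gamma>" by (simp_all add: \<beta>_def \<gamma>_def)
  have 2: "r\<^sup>2 - 2 * B + C = (p + r - 1)\<^sup>2 \<longleftrightarrow> \<gamma> - 2 * \<beta> = 1 - 2 * (p + r)"
    unfolding B C by (auto simp: algebra_simps power2_eq_square)
  have "s\<^sup>2 * r\<^sup>2 + 2 * s * t * B + t\<^sup>2 * C - (t * p - s * r)\<^sup>2 = t * (t * \<gamma> + 2 * s * \<beta>)"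
    unfolding B C by algebra
  then have 4: "s\<^sup>2 * r\<^sup>2 + 2 * s * t * B + t\<^sup>2 * C = (t * p - s * r)\<^sup>2 \<longleftrightarrow> t * \<gamma> + 2 * s * \<beta> = 0"
    using assms(2) by (metis eq_iff_diff_eq_0 mult_eq_0_iff)
  \<comment> \<open>The third equation becomes linear only modulo the fourth one.\<close>
  have "s\<^sup>2 * r\<^sup>2 + 2 * s * (t - 1) * B + (t - 1)\<^sup>2 * C - (s * (1 - r) + (t - 1) * p)\<^sup>2 =
     (1 - t) * \<gamma> - s * (2 * ((t - 1) * p - s * r) + s)" if "t * \<gamma> + 2 * s * \<beta> = 0"
    using that unfolding B C by algebra
  then have 3: "s\<^sup>2 * r\<^sup>2 + 2 * s * (t - 1) * B + (t - 1)\<^sup>2 * C = (s * (1 - r) + (t - 1) * p)\<^sup>2 \<longleftrightarrow>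
     (1 - t) * \<gamma> = s * (2 * ((t - 1) * p - s * r) + s)" if "t * \<gamma> + 2 * s * \<beta> = 0"
    using that by (metis eq_iff_diff_eq_0)
  have "?R \<longleftrightarrow> A = r\<^sup>2 \<and> t * \<gamma> + 2 * s * \<beta> = 0 \<and>
      \<gamma> - 2 * \<beta> = 1 - 2 * (p + r) \<and> (1 - t) * \<gamma> = s * (2 * ((t - 1) * p - s * r) + s)"
    using B C by auto
  then show ?thesis unfolding tangent_system_def using 2 3 4 by blast
qed

text \<open>Eliminating the two unknowns \<open>\<beta>\<close> and \<open>\<gamma>\<close> from
  three linear equations leaves the equation of the line through the midpoints of the diagonals,
  times \<open>s * (s + t - 1)\<close>.\<close>

lemma tangent_system_line:
  assumes "s \<noteq> 0" "t \<noteq> 0" "s + t \<noteq> 1" "tangent_system s t p r A B C"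
  shows "(1 + s) * (2 * r - 1) = 2 * (t - 1) * p"
proof -
  obtain \<beta> \<gamma> where 1: "t * \<gamma> + 2 * s * \<beta> = 0" "\<gamma> - 2 * \<beta> = 1 - 2 * (p + r)"
    "(1 - t) * \<gamma> = s * (2 * ((t - 1) * p - s * r) + s)"
    using assms tangent_system_reduced by metis
  have "s * ((s + t - 1) * ((1 + s) * (2 * r - 1) - 2 * (t - 1) * p)) = 0"
    using 1 by algebra
  with assms show ?thesis by simp
qed

text \<open>After elimination of \<open>\<beta>\<close> two equations for \<open>\<gamma>\<close>
  remain, with coefficients \<open>s + t\<close> and \<open>1 - t\<close>. These vanish together
  only for a parallelogram, and the line equation makes the two compatible.\<close>

lemma tangent_system_solvable:
  assumes "s \<noteq> 0" "t \<noteq> 0" "\<not> (s = -1 \<and> t = 1)" "(1 + s) * (2 * r - 1) = 2 * (t - 1) * p"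
  shows "\<exists>A B C. tangent_system s t p r A B C"
proof -
  obtain \<gamma> where g: "(s + t) * \<gamma> = s * (1 - 2 * (p + r))" "(1 - t) * \<gamma> = s * (2 * ((t - 1) * p - s * r) + s)"
  \<comment> \<open>For \<open>t \<noteq> 1\<close> the second equation determines
    \<open>\<gamma>\<close>. For \<open>t = 1\<close> the line is \<open>r = 1 / 2\<close>, the
    second equation is trivial, and the first determines \<open>\<gamma>\<close>.\<close>
  proof (cases "t = 1")
    case False
    have "(s + t) * (s * (2 * ((t - 1) * p - s * r) + s)) = (1 - t) * (s * (1 - 2 * (p + r)))"
      using assms(4) by algebra
    with False that[of "s * (2 * ((t - 1) * p - s * r) + s) / (1 - t)"] show ?thesis
      by (simp add: field_simps)
  next
    case True
    with assms(3) have "s + 1 \<noteq> 0" by auto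
    have "2 * ((t - 1) * p - s * r) + s = 0"
    proof -
      have "(1 + s) * (2 * r - 1) = 0" using assms(4) True by simp
      with \<open>s + 1 \<noteq> 0\<close> have "2 * r = 1" by simp
      with True show ?thesis by simp
    qed
    with True \<open>s + 1 \<noteq> 0\<close> that[of "s * (1 - 2 * (p + r)) / (s + t)"] show ?thesis by simp
  qed
  define \<beta> where "\<beta> = - t * \<gamma> / (2 * s)"
  have b: "t * \<gamma> + 2 * s * \<beta> = 0" using assms(1) by (simp add: \<beta>_def)
  have "s * (\<gamma> - 2 * \<beta>) = s * (1 - 2 * (p + r))" using b g(1) by algebra
  with assms(1) have "\<gamma> - 2 * \<beta> = 1 - 2 * (p + r)" by simp
  with b g(2) have "tangent_system s t p r (r\<^sup>2) (\<beta> - p * r) (p\<^sup>2 + \<gamma>)"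
    unfolding tangent_system_reduced[OF assms(1,2)] by blast
  then show ?thesis by blast
qed

text \<open>The degenerate solutions are the pairs of vertices on the two diagonals and the pair of
  hidden vertices, each counted as the envelope of the lines through either point.\<close>

lemma tangent_system_degenerate:
  assumes "s \<noteq> 0" "t \<noteq> 0" "s + t \<noteq> 1" "\<not> (s = -1 \<and> t = 1)" "tangent_system s t p r A B C" "A * C - B\<^sup>2 = 0"
  shows "p = 0 \<and> r = 1 / 2 \<or> p = (1 + s) / 2 \<and> r = t / 2 \<or>
    t \<noteq> 1 \<and> s + t \<noteq> 0 \<and> p = (s / (1 - t) + s / (s + t)) / 2 \<and> r = t / (s + t) / 2"
proof -
  have line: "(1 + s) * (2 * r - 1) = 2 * (t - 1) * p" using tangent_system_line assms by metis
  obtain \<beta> \<gamma> where 0: "A = r\<^sup>2" "B = \<beta> - p * r" "C = p\<^sup>2 + \<gamma>" and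
    eqs: "t * \<gamma> + 2 * s * \<beta> = 0" "\<gamma> - 2 * \<beta> = 1 - 2 * (p + r)"
    "(1 - t) * \<gamma> = s * (2 * ((t - 1) * p - s * r) + s)"
    using assms tangent_system_reduced by metis
  \<comment> \<open>This product is \<open>- t\<close> times the determinant
    \<open>A * C - B\<^sup>2\<close>. The factor \<open>\<beta>\<close> yields the midpoint of the
    first diagonal, the other factor the remaining midpoints.\<close>
  have "\<beta> * (t * \<beta> - 2 * r * (t * p - s * r)) = 0"
    using 0 eqs(1) assms(6) by algebra
  then consider "\<beta> = 0" | "t * \<beta> = 2 * r * (t * p - s * r)" by auto
  then show ?thesis
  proof cases
    case 1
    with eqs(1) assms(2) have "\<gamma> = 0" by simp
    with 1 eqs(2) have pr: "2 * r = 1 - 2 * p" by simp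
    have "s * (2 * ((s + t - 1) * p)) = 0" using eqs(3) pr \<open>\<gamma> = 0\<close> by algebra
    with assms(1,3) pr show ?thesis by simp
  next
    case 2
    \<comment> \<open>\<open>e1\<close> and \<open>e2\<close> arise from the other two linear
      equations by eliminating \<open>\<beta>\<close> and \<open>\<gamma>\<close>.\<close>
    have e1: "4 * r * (t * p - s * r) * (s + t) = t\<^sup>2 * (2 * p + 2 * r - 1)"
    proof -
      have "s * (4 * r * (t * p - s * r) * (s + t) - t\<^sup>2 * (2 * p + 2 * r - 1)) = 0"
        using eqs 2 by algebra
      with assms(1) show ?thesis by simp
    qed
    have e2: "4 * (t - 1) * r * (t * p - s * r) = t\<^sup>2 * (2 * (t - 1) * p - 2 * s * r + s)"
    proof -
      have "s * (4 * (t - 1) * r * (t * p - s * r) - t\<^sup>2 * (2 * (t - 1) * p - 2 * s * r + s)) = 0"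
        using eqs 2 by algebra
      with assms(1) show ?thesis by simp
    qed
    \<comment> \<open>Either one of the two pairs of opposite sides is parallel, or none is.\<close>
    consider "t = 1" "s + 1 \<noteq> 0" | "t \<noteq> 1" "s + t = 0" | "t \<noteq> 1" "s + t \<noteq> 0"
      using assms(4) by fastforce
    then show ?thesis
    proof cases
      case 1
      then have r: "r = 1 / 2" using line by simp
      have "s * (2 * p - (1 + s)) = 0" using e1 unfolding r 1(1) by (simp add: algebra_simps)
      with assms(1) r 1 show ?thesis by simp
    next
      case 2
      have "(t - 1) * (2 * p + 2 * r - 1) = 0" using line 2(2) by algebra
      with 2(1) have p: "2 * p = 1 - 2 * r" by simp
      have s: "s = - t" using 2(2) by simp
      have "t * (2 * r - t) = 0" using e2 p s by algebra
      with assms(2) have "r = t / 2" by simp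
      with p s show ?thesis by simp
    next
      case 3
      \<comment> \<open>On the line, \<open>e1\<close> splits into factors for the second
        coordinates of the second diagonal's midpoint and of the third diagonal midpoint.\<close>
      have "(s + t) * ((2 * r - t) * (2 * r * (s + t) - t)) = 0"
        using e1 line by algebra
      with 3 consider "r = t / 2" | "2 * r * (s + t) = t" by fastforce
      then show ?thesis
      proof cases
        case 1
        with line have "(t - 1) * (2 * p - (1 + s)) = 0" by (simp add: algebra_simps)
        with 1 3 show ?thesis by simp
      next
        case 2
        then have r: "r = t / (s + t) / 2" using 3 by (simp add: field_simps)
        have "p * (2 * ((1 - t) * (s + t))) = s * (s + t) + s * (1 - t)"
          using line 2 by algebra
        moreover have "s / (1 - t) + s / (s + t) = (s * (s + t) + s * (1 - t)) / ((1 - t) * (s + t))"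
          using 3 by (intro add_frac_eq) auto
        moreover have "(1 - t) * (s + t) \<noteq> 0" using 3 by simp
        ultimately have "p = (s / (1 - t) + s / (s + t)) / 2"
          by (metis eq_divide_eq divide_divide_eq_left mult.commute zero_neq_numeral)
        with r 3 show ?thesis by blast
      qed
    qed
  qed
qed

section \<open>Affine coordinates\<close>

text \<open>Change of basis by the matrix with columns \<open>a\<close> and \<open>b\<close>. The
  new coefficients are divided by \<open>(det2 a b)\<^sup>2\<close> because the squared determinants
  in the tangency equations carry the same factor, which then cancels.\<close>

lemma form_basis:
  assumes "det2 a b \<noteq> 0"
  shows "\<exists>A' B' C'. A * C - B\<^sup>2 = (det2 a b)\<^sup>2 * (A' * C' - B'\<^sup>2) \<and>
    (\<forall>x y. A * ((x *\<^sub>R a + y *\<^sub>R b) $ 1)\<^sup>2 + 2 * B * (x *\<^sub>R a + y *\<^sub>R b) $ 1 * (x *\<^sub>R a + y *\<^sub>R b) $ 2 +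
       C * ((x *\<^sub>R a + y *\<^sub>R b) $ 2)\<^sup>2 = (det2 a b)\<^sup>2 * (A' * x\<^sup>2 + 2 * B' * x * y + C' * y\<^sup>2))"
proof -
  define D where "D = det2 a b"
  define F G K where "F = A * (a $ 1)\<^sup>2 + 2 * B * a $ 1 * a $ 2 + C * (a $ 2)\<^sup>2"
    and "G = A * a $ 1 * b $ 1 + B * (a $ 1 * b $ 2 + a $ 2 * b $ 1) + C * a $ 2 * b $ 2"
    and "K = A * (b $ 1)\<^sup>2 + 2 * B * b $ 1 * b $ 2 + C * (b $ 2)\<^sup>2"
  define F' G' K' where "F' = F / D\<^sup>2" and "G' = G / D\<^sup>2" and "K' = K / D\<^sup>2"
  have F: "F = D\<^sup>2 * F'" and G: "G = D\<^sup>2 * G'" and K: "K = D\<^sup>2 * K'"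
    using assms by (simp_all add: F'_def G'_def K'_def D_def)
  have "F * K - G\<^sup>2 = D\<^sup>2 * (A * C - B\<^sup>2)"
    unfolding F_def G_def K_def D_def det2_def by algebra
  then have "D\<^sup>2 * (A * C - B\<^sup>2) = D\<^sup>2 * (D\<^sup>2 * (F' * K' - G'\<^sup>2))"
    unfolding F G K by algebra
  moreover have "D\<^sup>2 \<noteq> 0" using assms by (simp add: D_def)
  ultimately have "A * C - B\<^sup>2 = D\<^sup>2 * (F' * K' - G'\<^sup>2)" by (metis mult_left_cancel)
  moreover have "A * ((x *\<^sub>R a + y *\<^sub>R b) $ 1)\<^sup>2 + 2 * B * (x *\<^sub>R a + y *\<^sub>R b) $ 1 * (x *\<^sub>R a + y *\<^sub>R b) $ 2 +
       C * ((x *\<^sub>R a + y *\<^sub>R b) $ 2)\<^sup>2 = D\<^sup>2 * (F' * x\<^sup>2 + 2 * G' * x * y + K' * y\<^sup>2)" for x y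
  proof -
    have "A * ((x *\<^sub>R a + y *\<^sub>R b) $ 1)\<^sup>2 + 2 * B * (x *\<^sub>R a + y *\<^sub>R b) $ 1 * (x *\<^sub>R a + y *\<^sub>R b) $ 2 +
       C * ((x *\<^sub>R a + y *\<^sub>R b) $ 2)\<^sup>2 = F * x\<^sup>2 + 2 * G * x * y + K * y\<^sup>2"
      unfolding F_def G_def K_def by simp algebra
    then show ?thesis unfolding F G K by algebra
  qed
  ultimately show ?thesis unfolding D_def by blast
qed

text \<open>The inverse change of basis, composed with the adjugate matrix; this produces the factor
  \<open>(det2 a b)\<^sup>2\<close> without division.\<close>

lemma form_basis_inverse:
  "\<exists>A B C. A * C - B\<^sup>2 = (det2 a b)\<^sup>2 * (A' * C' - B'\<^sup>2) \<and>
    (\<forall>x y. A * ((x *\<^sub>R a + y *\<^sub>R b) $ 1)\<^sup>2 + 2 * B * (x *\<^sub>R a + y *\<^sub>R b) $ 1 * (x *\<^sub>R a + y *\<^sub>R b) $ 2 +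
       C * ((x *\<^sub>R a + y *\<^sub>R b) $ 2)\<^sup>2 = (det2 a b)\<^sup>2 * (A' * x\<^sup>2 + 2 * B' * x * y + C' * y\<^sup>2))"
proof -
  define A B C where "A = A' * (b $ 2)\<^sup>2 - 2 * B' * a $ 2 * b $ 2 + C' * (a $ 2)\<^sup>2"
    and "B = - A' * b $ 1 * b $ 2 + B' * (a $ 1 * b $ 2 + a $ 2 * b $ 1) - C' * a $ 1 * a $ 2"
    and "C = A' * (b $ 1)\<^sup>2 - 2 * B' * a $ 1 * b $ 1 + C' * (a $ 1)\<^sup>2"
  have "A * C - B\<^sup>2 = (det2 a b)\<^sup>2 * (A' * C' - B'\<^sup>2)"
    unfolding A_def B_def C_def det2_def by algebra
  moreover have "A * ((x *\<^sub>R a + y *\<^sub>R b) $ 1)\<^sup>2 + 2 * B * (x *\<^sub>R a + y *\<^sub>R b) $ 1 * (x *\<^sub>R a + y *\<^sub>R b) $ 2 +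
       C * ((x *\<^sub>R a + y *\<^sub>R b) $ 2)\<^sup>2 = (det2 a b)\<^sup>2 * (A' * x\<^sup>2 + 2 * B' * x * y + C' * y\<^sup>2)" for x y
    unfolding A_def B_def C_def det2_def vector_add_component vector_scaleR_component real_scaleR_def
    by algebra
  ultimately show ?thesis by blast
qed

locale affine_frame =
  fixes q a b :: plane
  assumes basis: "det2 a b \<noteq> 0"
begin

definition pt :: "real \<Rightarrow> real \<Rightarrow> plane" where
  "pt x y = q + x *\<^sub>R a + y *\<^sub>R b"

lemma pt_diff: "pt x' y' - pt x y = (x' - x) *\<^sub>R a + (y' - y) *\<^sub>R b"
  by (simp add: pt_def algebra_simps)

lemma det2_pt:
  "det2 (pt x' y' - pt x y) (pt z' w' - pt z w) =
    det2 a b * ((x' - x) * (w' - w) - (y' - y) * (z' - z))"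
  unfolding pt_diff by (simp add: det2_def algebra_simps)

lemma pt_eq_iff: "pt x y = pt x' y' \<longleftrightarrow> x = x' \<and> y = y'"
proof
  assume "pt x y = pt x' y'"
  then have "pt x y - pt x' y' = 0" by simp
  then have "det2 (pt 1 0 - pt 0 0) (pt x y - pt x' y') = 0" "det2 (pt 0 1 - pt 0 0) (pt x y - pt x' y') = 0"
    by (simp_all add: det2_def)
  with basis show "x = x' \<and> y = y'" unfolding det2_pt by simp
qed simp

lemma ex_pt: "\<exists>x y. z = pt x y"
proof -
  \<comment> \<open>Cramer's rule.\<close>
  have "z = pt (det2 (z - q) b / det2 a b) (det2 a (z - q) / det2 a b)"
    using basis by (simp add: pt_def plane_eq_iff field_simps) (simp add: det2_def algebra_simps)
  then show ?thesis by blast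
qed

lemma midpoint_pt: "midpoint (pt x y) (pt x' y') = pt ((x + x') / 2) ((y + y') / 2)"
  by (simp add: pt_def plane_eq_iff midpoint_def field_simps)

lemma pt_mem_line_through:
  assumes "x \<noteq> x' \<or> y \<noteq> y'"
  shows "pt z w \<in> line_through (pt x y) (pt x' y') \<longleftrightarrow> (x' - x) * (w - y) = (y' - y) * (z - x)"
  using assms basis by (subst mem_line_through_iff) (auto simp: pt_eq_iff det2_pt)

lemma affine_parallel_pt:
  assumes "x \<noteq> x' \<or> y \<noteq> y'" "z \<noteq> z' \<or> w \<noteq> w'"
  shows "affine_parallel (line_through (pt x y) (pt x' y')) (line_through (pt z w) (pt z' w')) \<longleftrightarrow>
    (x' - x) * (w' - w) = (y' - y) * (z' - z)"
  using assms basis by (subst affine_parallel_iff_det2) (auto simp: pt_eq_iff det2_pt)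

lemma collinear_pt:
  assumes "x \<noteq> x' \<or> y \<noteq> y'"
  shows "collinear {pt x y, pt x' y', pt z w} \<longleftrightarrow> (x' - x) * (w - y) = (y' - y) * (z - x)"
  using assms basis by (subst collinear_iff_det2) (auto simp: pt_eq_iff det2_pt)

text \<open>An affine map does not preserve the axes of a conic, so only its dual form is moved to
  the frame; nondegeneracy is preserved. The assumption keeps the vertices of each side
  distinct.\<close>

lemma center_of_tangent_conic_pt:
  assumes "s \<noteq> 0"
  shows "center_of_tangent_conic (extended_sides (pt 0 0) (pt 1 0) (pt 0 1) (pt s t)) (pt p r) \<longleftrightarrow>
    (\<exists>A B C. A * C - B\<^sup>2 \<noteq> 0 \<and> tangent_system s t p r A B C)"
proof -
  define S where "S = {(pt 0 0, pt 1 0), (pt 1 0, pt 0 1), (pt 0 1, pt s t), (pt s t, pt 0 0)}"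
  have S: "extended_sides (pt 0 0) (pt 1 0) (pt 0 1) (pt s t) = (\<lambda>(p, q). line_through p q) ` S"
    by (simp add: S_def extended_sides_def)
  have sides: "(\<forall>(z, w)\<in>S. A * ((w - z) $ 1)\<^sup>2 + 2 * B * (w - z) $ 1 * (w - z) $ 2 + C * ((w - z) $ 2)\<^sup>2 =
       (det2 (w - z) (z - pt p r))\<^sup>2) \<longleftrightarrow> tangent_system s t p r A' B' C'"
    if "\<forall>x y. A * ((x *\<^sub>R a + y *\<^sub>R b) $ 1)\<^sup>2 + 2 * B * (x *\<^sub>R a + y *\<^sub>R b) $ 1 * (x *\<^sub>R a + y *\<^sub>R b) $ 2 +
       C * ((x *\<^sub>R a + y *\<^sub>R b) $ 2)\<^sup>2 = (det2 a b)\<^sup>2 * (A' * x\<^sup>2 + 2 * B' * x * y + C' * y\<^sup>2)"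
    for A B C A' B' C'
  proof -
    have side: "A * ((pt x' y' - pt x y) $ 1)\<^sup>2 + 2 * B * (pt x' y' - pt x y) $ 1 * (pt x' y' - pt x y) $ 2 +
        C * ((pt x' y' - pt x y) $ 2)\<^sup>2 = (det2 (pt x' y' - pt x y) (pt x y - pt p r))\<^sup>2 \<longleftrightarrow>
      A' * (x' - x)\<^sup>2 + 2 * B' * (x' - x) * (y' - y) + C' * (y' - y)\<^sup>2 =
      ((x' - x) * (y - r) - (y' - y) * (x - p))\<^sup>2" for x y x' y'
      unfolding det2_pt power_mult_distrib using basis
      by (simp only: pt_diff that) simp
    have *: "((\<forall>(z, w)\<in>S. P z w) \<longleftrightarrow>
       P (pt 0 0) (pt 1 0) \<and> P (pt 1 0) (pt 0 1) \<and> P (pt 0 1) (pt s t) \<and> P (pt s t) (pt 0 0))" for P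
      by (simp add: S_def)
    show ?thesis
      unfolding * side tangent_system_def
      by (simp add: power2_commute[of 1] algebra_simps power2_eq_square)
  qed
  have ne: "z \<noteq> w" if "(z, w) \<in> S" for z w
    using that assms by (auto simp: S_def pt_eq_iff)
  let ?L = "\<exists>A B C. A * C - B\<^sup>2 \<noteq> 0 \<and> (\<forall>(z, w)\<in>S. A * ((w - z) $ 1)\<^sup>2 + 
      2 * B * (w - z) $ 1 * (w - z) $ 2 + C * ((w - z) $ 2)\<^sup>2 = (det2 (w - z) (z - pt p r))\<^sup>2)"
  have "center_of_tangent_conic ((\<lambda>(p, q). line_through p q) ` S) (pt p r) \<longleftrightarrow> ?L"
  proof (rule center_of_tangent_conic_iff)
    show "S \<noteq> {}" by (simp add: S_def)
  qed (rule ne)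
  also have "?L \<longleftrightarrow> (\<exists>A B C. A * C - B\<^sup>2 \<noteq> 0 \<and> tangent_system s t p r A B C)"
  proof
    assume ?L
    then obtain A B C where n: "A * C - B\<^sup>2 \<noteq> 0" and t: "\<forall>(z, w)\<in>S. A * ((w - z) $ 1)\<^sup>2 + 
      2 * B * (w - z) $ 1 * (w - z) $ 2 + C * ((w - z) $ 2)\<^sup>2 = (det2 (w - z) (z - pt p r))\<^sup>2"
      by blast
    obtain A' B' C' where f: "A * C - B\<^sup>2 = (det2 a b)\<^sup>2 * (A' * C' - B'\<^sup>2)" and
      g: "\<forall>x y. A * ((x *\<^sub>R a + y *\<^sub>R b) $ 1)\<^sup>2 + 2 * B * (x *\<^sub>R a + y *\<^sub>R b) $ 1 * (x *\<^sub>R a + y *\<^sub>R b) $ 2 +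
       C * ((x *\<^sub>R a + y *\<^sub>R b) $ 2)\<^sup>2 = (det2 a b)\<^sup>2 * (A' * x\<^sup>2 + 2 * B' * x * y + C' * y\<^sup>2)"
      using form_basis[OF basis, of A C B] by blast
    have "A' * C' - B'\<^sup>2 \<noteq> 0" using n unfolding f by auto
    with sides[OF g] t show "\<exists>A B C. A * C - B\<^sup>2 \<noteq> 0 \<and> tangent_system s t p r A B C"
      by blast
  next
    assume "\<exists>A B C. A * C - B\<^sup>2 \<noteq> 0 \<and> tangent_system s t p r A B C"
    then obtain A' B' C' where t: "A' * C' - B'\<^sup>2 \<noteq> 0" "tangent_system s t p r A' B' C'" by blast
    obtain A B C where f: "A * C - B\<^sup>2 = (det2 a b)\<^sup>2 * (A' * C' - B'\<^sup>2)" and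
      g: "\<forall>x y. A * ((x *\<^sub>R a + y *\<^sub>R b) $ 1)\<^sup>2 + 2 * B * (x *\<^sub>R a + y *\<^sub>R b) $ 1 * (x *\<^sub>R a + y *\<^sub>R b) $ 2 +
       C * ((x *\<^sub>R a + y *\<^sub>R b) $ 2)\<^sup>2 = (det2 a b)\<^sup>2 * (A' * x\<^sup>2 + 2 * B' * x * y + C' * y\<^sup>2)"
      using form_basis_inverse[of a b A' C' B'] by blast
    have "A * C - B\<^sup>2 \<noteq> 0" unfolding f using t(1) basis by simp
    with sides[OF g] t(2) show ?L
      by blast
  qed
  finally show ?thesis unfolding S .
qed

lemma third_diagonal_midpoint_pt:
  assumes "s \<noteq> 0" "t \<noteq> 1" "s + t \<noteq> 0"
  shows "third_diagonal_midpoint (pt 0 0) (pt 1 0) (pt 0 1) (pt s t) =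
    pt ((s / (1 - t) + s / (s + t)) / 2) (t / (s + t) / 2)"
proof -
  have 1: "line_through (pt 0 0) (pt 1 0) \<inter> line_through (pt 0 1) (pt s t) = {pt (s / (1 - t)) 0}"
  proof (rule set_eqI)
    fix z
    obtain x y where z: "z = pt x y" using ex_pt by blast
    have "y = 0 \<and> s * (y - 1) = (t - 1) * x \<longleftrightarrow> x = s / (1 - t) \<and> y = 0"
      using assms by (auto simp: field_simps)
    then show "z \<in> line_through (pt 0 0) (pt 1 0) \<inter> line_through (pt 0 1) (pt s t) \<longleftrightarrow> z \<in> {pt (s / (1 - t)) 0}"
      unfolding z using assms by (simp add: pt_mem_line_through pt_eq_iff)
  qed
  have 2: "line_through (pt 1 0) (pt 0 1) \<inter> line_through (pt s t) (pt 0 0) = {pt (s / (s + t)) (t / (s + t))}"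
  proof (rule set_eqI)
    fix z
    obtain x y where z: "z = pt x y" using ex_pt by blast
    have "- y = x - 1 \<and> - s * (y - t) = - t * (x - s) \<longleftrightarrow> x = s / (s + t) \<and> y = t / (s + t)"
    proof
      assume h: "- y = x - 1 \<and> - s * (y - t) = - t * (x - s)"
      then have "x * (s + t) = s" "y * (s + t) = t" by algebra+
      with assms show "x = s / (s + t) \<and> y = t / (s + t)" by (simp add: field_simps)
    next
      assume "x = s / (s + t) \<and> y = t / (s + t)"
      with assms have h: "x * (s + t) = s" "y * (s + t) = t" by simp_all
      \<comment> \<open>Both line equations are checked after multiplication by
        \<open>s + t\<close>, which clears the denominators.\<close>
      have "(s + t) * (x + y - 1) = x * (s + t) + y * (s + t) - (s + t)"
        "(s + t) * (t * x - s * y) = t * (x * (s + t)) - s * (y * (s + t))" by algebra+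
      then have "(s + t) * (x + y - 1) = 0" "(s + t) * (t * x - s * y) = 0"
        unfolding h by simp_all
      with assms(3) have "x + y = 1" "t * x = s * y" by simp_all
      then show "- y = x - 1 \<and> - s * (y - t) = - t * (x - s)" by (simp add: algebra_simps)
    qed
    then show "z \<in> line_through (pt 1 0) (pt 0 1) \<inter> line_through (pt s t) (pt 0 0) \<longleftrightarrow> 
      z \<in> {pt (s / (s + t)) (t / (s + t))}"
      unfolding z using assms by (simp add: pt_mem_line_through pt_eq_iff)
  qed
  show ?thesis unfolding third_diagonal_midpoint_def 1 2 the_elem_eq midpoint_pt by simp
qed

end

section \<open>The quadrilateral in the frame of its first three vertices\<close>

lemma affine_frame_of_quadrilateral:
  assumes "\<not> collinear {q1, q2, q3}"
  obtains z a b s t where "affine_frame a b" "q1 = affine_frame.pt z a b 0 0"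
    "q2 = affine_frame.pt z a b 1 0" "q3 = affine_frame.pt z a b 0 1" "q4 = affine_frame.pt z a b s t"
proof -
  have "q1 \<noteq> q2" using assms by auto
  with assms have "det2 (q2 - q1) (q3 - q1) \<noteq> 0" by (simp add: collinear_iff_det2)
  then interpret affine_frame q1 "q2 - q1" "q3 - q1" by unfold_locales
  obtain s t where "q4 = pt s t" using ex_pt by blast
  then show thesis using that[OF affine_frame_axioms, of q1] by (simp add: pt_def)
qed

theorem theorem4p3:
  fixes q1 q2 q3 q4 :: "real ^ 2"
  assumes not_parallelogram: "\<not> parallelogram q1 q2 q3 q4"
    and no_three_collinear:
      "\<not> collinear {q1, q2, q3}" "\<not> collinear {q1, q2, q4}"
      "\<not> collinear {q1, q3, q4}" "\<not> collinear {q2, q3, q4}"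
  shows "\<exists>L. is_line L \<and>
    (midpoint q1 q3 \<in> L \<and> midpoint q2 q4 \<in> L \<and>
      (\<not> trapezoid q1 q2 q3 q4 \<longrightarrow> third_diagonal_midpoint q1 q2 q3 q4 \<in> L)) \<and>
    (\<forall>c. center_of_tangent_conic (extended_sides q1 q2 q3 q4) c \<longrightarrow> c \<in> L) \<and>
    (\<forall>c \<in> L. c \<noteq> midpoint q1 q3 \<and> c \<noteq> midpoint q2 q4 \<and>
        (\<not> trapezoid q1 q2 q3 q4 \<longrightarrow> c \<noteq> third_diagonal_midpoint q1 q2 q3 q4) \<longrightarrow>
      center_of_tangent_conic (extended_sides q1 q2 q3 q4) c)"
proof -
  obtain z a b s t where fr: "affine_frame a b" and q: "q1 = affine_frame.pt z a b 0 0"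
    "q2 = affine_frame.pt z a b 1 0" "q3 = affine_frame.pt z a b 0 1" "q4 = affine_frame.pt z a b s t"
    using affine_frame_of_quadrilateral[OF no_three_collinear(1)] by metis
  interpret affine_frame z a b by (rule fr)
  define L where "L = line_through (midpoint q1 q3) (midpoint q2 q4)"
  \<comment> \<open>The remaining collinearity hypotheses keep the fourth vertex off the three lines
    joining the first three vertices.\<close>
  have t0: "t \<noteq> 0"
    using no_three_collinear(2) unfolding q by (simp add: collinear_pt)
  have s0: "s \<noteq> 0"
    using no_three_collinear(3) unfolding q by (simp add: collinear_pt)
  have st1: "s + t \<noteq> 1"
    using no_three_collinear(4) unfolding q by (auto simp: collinear_pt)
  have par: "affine_parallel (line_through q1 q2) (line_through q3 q4) \<longleftrightarrow> t = 1"
    "affine_parallel (line_through q2 q3) (line_through q4 q1) \<longleftrightarrow> s + t = 0"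
    unfolding q using s0 by (auto simp: affine_parallel_pt)
  \<comment> \<open>Hence the midpoints of the diagonals are distinct and \<open>L\<close> is a
    line.\<close>
  have np: "\<not> (s = -1 \<and> t = 1)"
    using not_parallelogram by (auto simp: parallelogram_def par)
  have m: "midpoint q1 q3 = pt 0 (1 / 2)" "midpoint q2 q4 = pt ((1 + s) / 2) (t / 2)"
    unfolding q by (simp_all add: midpoint_pt)
  have mem: "pt p r \<in> L \<longleftrightarrow> (1 + s) * (2 * r - 1) = 2 * (t - 1) * p" for p r
    unfolding L_def m using np by (subst pt_mem_line_through) (auto simp: field_simps)
  have sides: "extended_sides q1 q2 q3 q4 = extended_sides (pt 0 0) (pt 1 0) (pt 0 1) (pt s t)"
    unfolding q ..
  have third: "third_diagonal_midpoint q1 q2 q3 q4 = pt ((s / (1 - t) + s / (s + t)) / 2) (t / (s + t) / 2)"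
    if "t \<noteq> 1" "s + t \<noteq> 0"
    unfolding q by (rule third_diagonal_midpoint_pt[OF s0 that])
  have trap: "trapezoid q1 q2 q3 q4 \<longleftrightarrow> t = 1 \<or> s + t = 0"
    by (simp add: trapezoid_def par)
  have "pt 0 (1 / 2) \<noteq> pt ((1 + s) / 2) (t / 2)" using np by (auto simp: pt_eq_iff)
  then have "is_line L" unfolding L_def is_line_def m line_through_def by blast
  moreover have "midpoint q1 q3 \<in> L" "midpoint q2 q4 \<in> L"
    by (simp_all add: L_def line_through_def hull_inc)
  moreover have "third_diagonal_midpoint q1 q2 q3 q4 \<in> L" if "\<not> trapezoid q1 q2 q3 q4"
  proof -
    have nt: "t \<noteq> 1" "s + t \<noteq> 0" using that trap by auto
    \<comment> \<open>First coordinates of the hidden vertices. The second hidden vertex lies on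
      \<open>x + y = 1\<close>, so its second coordinate is \<open>1 - g\<close>.\<close>
    define f g where "f = s / (1 - t)" and "g = s / (s + t)"
    have fg: "f * (1 - t) = s" "g * (s + t) = s" using nt by (simp_all add: f_def g_def)
    have "t / (s + t) = 1 - g" using nt by (simp add: g_def field_simps)
    moreover have "(1 + s) * (2 * ((1 - g) / 2) - 1) = 2 * (t - 1) * ((f + g) / 2)"
    proof -
      have "(1 + s) * (2 * ((1 - g) / 2) - 1) =
          2 * (t - 1) * ((f + g) / 2) + f * (1 - t) - g * (s + t)"
        by (simp add: field_simps)
      then show ?thesis unfolding fg by simp
    qed
    ultimately show ?thesis unfolding third[OF nt] mem f_def[symmetric] g_def[symmetric] by (simp only:)
  qed
  moreover have "c \<in> L" if c: "center_of_tangent_conic (extended_sides q1 q2 q3 q4) c" for c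
  proof -
    obtain p r where pr: "c = pt p r" using ex_pt by blast
    from c obtain A B C where "tangent_system s t p r A B C"
      unfolding sides pr center_of_tangent_conic_pt[OF s0] by blast
    then show ?thesis unfolding pr mem by (rule tangent_system_line[OF s0 t0 st1])
  qed
  moreover have "center_of_tangent_conic (extended_sides q1 q2 q3 q4) c"
    if c: "c \<in> L" "c \<noteq> midpoint q1 q3" "c \<noteq> midpoint q2 q4"
      "\<not> trapezoid q1 q2 q3 q4 \<longrightarrow> c \<noteq> third_diagonal_midpoint q1 q2 q3 q4" for c
  proof -
    obtain p r where pr: "c = pt p r" using ex_pt by blast
    obtain A B C where ts: "tangent_system s t p r A B C"
      using tangent_system_solvable[OF s0 t0 np] c(1) unfolding pr mem by blast
    \<comment> \<open>Whichever solution was obtained, its degeneracy would put \<open>c\<close> at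
      one of the excluded midpoints.\<close>
    have "A * C - B\<^sup>2 \<noteq> 0"
      using tangent_system_degenerate[OF s0 t0 st1 np ts] c(2-4) trap third
      unfolding pr m by (auto simp: pt_eq_iff)
    with ts show ?thesis unfolding sides pr center_of_tangent_conic_pt[OF s0] by blast
  qed
  ultimately show ?thesis by blast
qed

end
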